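(* Let $u=(u_k)_{k\in\mathbb N}\in c_0(\mathbb R)$. The following assertions hold: 1. $\operatorname{Argmax}(u)\subseteq \Delta^{\geqslant}_u$; 2. If $\mathbf K^{\geqslant}_u<+\infty$, then $\mathbf K^{\geqslant}_u=\min \operatorname{Argmax}(u)$; 3. If $\mathbf K^{>}_u<+\infty$, then $S_u^{0,\infty}>0$ and $\mathbf K^{>}_u=\max \operatorname{Argmax}(u)$; 4. $\operatorname{Argmax}(u)\neq\emptyset \iff \Delta^{\geqslant}_u\neq\emptyset$; 5. $\operatorname{Argmax}(u)=\emptyset \implies S_u^{0,\infty}=\lim_{k\to+\infty}u_k=0$.
   Context: $\mathbb N=\{0,1,2,\dots\}$. $c_0(\mathbb R)$ is the set of real sequences $u=(u_0,u_1,\dots)$ with $\lim_{n\to+\infty}u_n=0$. For $u\in c_0(\mathbb R)$ and $n\in\mathbb N$, $m\in\mathbb N\cup\{\infty\}$ with $n\le m$, $S_u^{n,m}$ denotes $\sup_{n\le k\le m}u_k$ if $m<\infty$ and $\sup_{k\ge n}u_k$ if $m=\infty$. Define $\operatorname{Argmax}(u)=\{k\in\mathbb N\mid u_k=S_u^{0,\infty}\}$, $\Delta^{\geqslant}_u=\{k\in\mathbb N\mid S_u^{0,k}\ge S_u^{k+1,\infty}\}$, $\Delta^{>}_u=\{k\in\mathbb N\mid S_u^{0,k}> S_u^{k+1,\infty}\}$, $\mathbf K^{\geqslant}_u=\inf\Delta^{\geqslant}_u$, $\mathbf K^{>}_u=\inf\Delta^{>}_u$, with the convention $\inf\emptyset=+\infty$.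 *)

theory Defs
  imports Complex_Main "HOL-Library.Extended_Nat"
begin

definition c0 :: "(nat \<Rightarrow> real) set" where
  "c0 = {u. u \<longlonglongrightarrow> 0}"

(* The real-valued supremum is the intended one only for a nonempty index range (n \<le> m) on which
   u is bounded above; both hold in every use below when u is in c0. *)
definition S :: "(nat \<Rightarrow> real) \<Rightarrow> nat \<Rightarrow> enat \<Rightarrow> real" where
  "S u n m = (SUP k\<in>{k. n \<le> k \<and> enat k \<le> m}. u k)"

definition Argmax :: "(nat \<Rightarrow> real) \<Rightarrow> nat set" where
  "Argmax u = {k. u k = S u 0 \<infinity>}"

definition Delta_ge :: "(nat \<Rightarrow> real) \<Rightarrow> nat set" where
  "Delta_ge u = {k. S u 0 (enat k) \<ge> S u (k + 1) \<infinity>}"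

definition Delta_gt :: "(nat \<Rightarrow> real) \<Rightarrow> nat set" where
  "Delta_gt u = {k. S u 0 (enat k) > S u (k + 1) \<infinity>}"

(* In enat, Inf {} = \<infinity>. *)
definition K_ge :: "(nat \<Rightarrow> real) \<Rightarrow> enat" where
  "K_ge u = Inf (enat ` Delta_ge u)"

definition K_gt :: "(nat \<Rightarrow> real) \<Rightarrow> enat" where
  "K_gt u = Inf (enat ` Delta_gt u)"

(* Min and Max are unspecified on infinite sets, and Argmax u may be infinite (e.g. u = 0).
   These predicates assert that the extremum exists, is attained, and equals x. *)
definition is_min :: "'a::linorder set \<Rightarrow> 'a \<Rightarrow> bool" where
  "is_min A x \<longleftrightarrow> x \<in> A \<and> (\<forall>y\<in>A. x \<le> y)"

definition is_max :: "'a::linorder set \<Rightarrow> 'a \<Rightarrow> bool" where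
  "is_max A x \<longleftrightarrow> x \<in> A \<and> (\<forall>y\<in>A. y \<le> x)"

end

theory Submission
  imports Defs
begin

text \<open>
  For every \<open>k\<close> the supremum over all indices is the larger of the head supremum over \<open>{0..k}\<close>
  and the tail supremum over \<open>{k+1..}\<close>.  The head is finite, so its supremum is attained.  Hence
  \<open>k \<in> Delta_ge u\<close> says that the global supremum equals the head supremum, i.e. that some maximiser
  is at most \<open>k\<close> (\<open>Delta_ge_iff_Argmax\<close>).  Thus \<open>Delta_ge u\<close> is the set of all indices from the
  first maximiser on, which yields assertions 1, 2 and 4.

  Membership of \<open>k\<close> in \<open>Delta_gt u\<close> says that the tail supremum beyond \<open>k\<close> is strictly below
  the global one, so that no maximiser lies beyond \<open>k\<close>.  At the least such \<open>k\<close> the index \<open>k\<close> must itself be a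
  maximiser, since otherwise \<open>k - 1\<close> would also belong to \<open>Delta_gt u\<close>
  (\<open>least_Delta_gt_in_Argmax\<close>).  The positivity in assertion 3 holds because every tail supremum
  is at least the limit \<open>0\<close>, and the head supremum exceeds one of them.

  Finally, a positive global supremum is attained, because far out the sequence stays below half of
  it (\<open>Argmax_nonempty_of_pos\<close>).  So if nothing attains it, it is both nonnegative and not
  positive.
\<close>

lemma c0_bdd_above:
  assumes "u \<in> c0"
  shows "bdd_above (range u)"
  using assms by (intro Bseq_bdd_above convergent_imp_Bseq convergentI) (simp add: c0_def)

lemma le_S_infinity:
  assumes "u \<in> c0" "n \<le> k"
  shows "u k \<le> S u n \<infinity>"
  unfolding S_def
  by (rule cSUP_upper) (use assms in \<open>auto intro: bdd_above_mono[OF c0_bdd_above]\<close>)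

lemma S_infinity_le:
  assumes "\<And>k. n \<le> k \<Longrightarrow> u k \<le> c"
  shows "S u n \<infinity> \<le> c"
  unfolding S_def by (rule cSUP_least) (use assms in auto)

lemma S_head_eq_Max: "S u 0 (enat k) = Max (u ` {..k})"
proof -
  have "{j. 0 \<le> j \<and> enat j \<le> enat k} = {..k}" by auto
  then show ?thesis by (simp add: S_def cSup_eq_Max)
qed

lemma le_S_head: "j \<le> k \<Longrightarrow> u j \<le> S u 0 (enat k)"
  by (simp add: S_head_eq_Max)

lemma S_head_attained: "\<exists>j\<le>k. u j = S u 0 (enat k)"
proof -
  have "Max (u ` {..k}) \<in> u ` {..k}" by (rule Max_in) auto
  then show ?thesis unfolding S_head_eq_Max by (metis atMost_iff imageE)
qed

lemma S_split:
  assumes "u \<in> c0"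
  shows "S u 0 \<infinity> = max (S u 0 (enat k)) (S u (k + 1) \<infinity>)"
proof (rule antisym)
  show "S u 0 \<infinity> \<le> max (S u 0 (enat k)) (S u (k + 1) \<infinity>)"
  proof (rule S_infinity_le)
    fix i
    show "u i \<le> max (S u 0 (enat k)) (S u (k + 1) \<infinity>)"
      using le_S_head[of i k u] le_S_infinity[OF assms, of "k + 1" i] by (cases "i \<le> k") auto
  qed
  obtain j where "u j = S u 0 (enat k)" using S_head_attained by blast
  then have "S u 0 (enat k) \<le> S u 0 \<infinity>" using le_S_infinity[OF assms, of 0 j] by simp
  moreover have "S u (k + 1) \<infinity> \<le> S u 0 \<infinity>"
    by (rule S_infinity_le) (simp add: le_S_infinity[OF assms])
  ultimately show "max (S u 0 (enat k)) (S u (k + 1) \<infinity>) \<le> S u 0 \<infinity>" by simp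
qed

text \<open>Each tail supremum bounds the terms of the tail, and hence also their limit \<open>0\<close>.\<close>

lemma S_infinity_nonneg:
  assumes "u \<in> c0"
  shows "0 \<le> S u n \<infinity>"
proof (rule LIMSEQ_le_const2)
  show "u \<longlonglongrightarrow> 0" using assms by (simp add: c0_def)
  show "\<exists>N. \<forall>k\<ge>N. u k \<le> S u n \<infinity>" using le_S_infinity[OF assms] by blast
qed

text \<open>
  By \<open>S_split\<close>, \<open>k \<in> Delta_ge u\<close> holds iff the head supremum is the global one; since the head
  supremum is attained, this is the existence of a maximiser in the head.
\<close>

lemma Delta_ge_iff_Argmax:
  assumes "u \<in> c0"
  shows "k \<in> Delta_ge u \<longleftrightarrow> (\<exists>j\<le>k. j \<in> Argmax u)"
proof
  assume "k \<in> Delta_ge u"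
  then have "S u 0 \<infinity> = S u 0 (enat k)" using S_split[OF assms, of k] by (simp add: Delta_ge_def)
  then show "\<exists>j\<le>k. j \<in> Argmax u" using S_head_attained[of k u] by (auto simp: Argmax_def)
next
  assume "\<exists>j\<le>k. j \<in> Argmax u"
  then obtain j where "j \<le> k" "u j = S u 0 \<infinity>" by (auto simp: Argmax_def)
  then show "k \<in> Delta_ge u"
    using le_S_head[of j k u] S_split[OF assms, of k] by (simp add: Delta_ge_def)
qed

lemma Argmax_le_Delta_gt:
  assumes "u \<in> c0" "k \<in> Delta_gt u" "i \<in> Argmax u"
  shows "i \<le> k"
proof (rule ccontr)
  assume "\<not> i \<le> k"
  then have "S u 0 \<infinity> \<le> S u (k + 1) \<infinity>"
    using le_S_infinity[OF assms(1), of "k + 1" i] assms(3) by (simp add: Argmax_def)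
  then show False using assms(2) S_split[OF assms(1), of k] by (simp add: Delta_gt_def)
qed

text \<open>
  If \<open>k\<close> were not a maximiser, then \<open>u k\<close> could be moved from the head to the tail: the head would
  keep its maximiser and the enlarged tail would still have a supremum below the global one.
\<close>

lemma least_Delta_gt_in_Argmax:
  assumes "u \<in> c0" "k \<in> Delta_gt u" and least: "\<And>i. i \<in> Delta_gt u \<Longrightarrow> k \<le> i"
  shows "k \<in> Argmax u"
proof (rule ccontr)
  assume not_max: "k \<notin> Argmax u"
  have tail: "S u (k + 1) \<infinity> < S u 0 \<infinity>"
    using assms(2) S_split[OF assms(1), of k] by (simp add: Delta_gt_def)
  have "u k < S u 0 \<infinity>"
    using not_max le_S_infinity[OF assms(1), of 0 k] by (simp add: Argmax_def)
  have "k \<in> Delta_ge u" using assms(2) by (simp add: Delta_ge_def Delta_gt_def)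
  then obtain j where j: "j \<le> k" "j \<in> Argmax u" using Delta_ge_iff_Argmax[OF assms(1)] by blast
  with not_max have "j < k" by (metis le_neq_implies_less)
  then obtain l where l: "k = l + 1" "j \<le> l" by (cases k) auto
  have "S u (l + 1) \<infinity> \<le> max (u k) (S u (k + 1) \<infinity>)"
  proof (rule S_infinity_le)
    fix i assume "l + 1 \<le> i"
    then show "u i \<le> max (u k) (S u (k + 1) \<infinity>)"
      using le_S_infinity[OF assms(1), of "k + 1" i] l(1) by (cases "i = k") auto
  qed
  also have "\<dots> < S u 0 \<infinity>" using tail \<open>u k < S u 0 \<infinity>\<close> by simp
  also have "\<dots> \<le> S u 0 (enat l)" using le_S_head[OF l(2), of u] j(2) by (simp add: Argmax_def)
  finally have "l \<in> Delta_gt u" by (simp add: Delta_gt_def)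
  with least l(1) show False by fastforce
qed

lemma Argmax_nonempty_of_pos:
  assumes "u \<in> c0" "0 < S u 0 \<infinity>"
  shows "Argmax u \<noteq> {}"
proof -
  have "eventually (\<lambda>i. u i < S u 0 \<infinity> / 2) sequentially"
    using assms order_tendstoD(2)[of u 0 sequentially "S u 0 \<infinity> / 2"] by (simp add: c0_def)
  then obtain N where "\<And>i. N \<le> i \<Longrightarrow> u i < S u 0 \<infinity> / 2"
    by (auto simp: eventually_sequentially)
  then have "S u (N + 1) \<infinity> \<le> S u 0 \<infinity> / 2" by (intro S_infinity_le) (simp add: less_imp_le)
  then have "S u (N + 1) \<infinity> < S u 0 \<infinity>" using assms(2) by linarith
  then have "N \<in> Delta_ge u" using S_split[OF assms(1), of N] by (simp add: Delta_ge_def)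
  then show ?thesis using Delta_ge_iff_Argmax[OF assms(1)] by blast
qed

lemma Inf_enat_image_least:
  assumes "Inf (enat ` A) < \<infinity>"
  obtains k where "Inf (enat ` A) = enat k" "is_min A k"
proof -
  have "enat ` A \<noteq> {}" using assms by (auto simp: top_enat_def)
  then have "Inf (enat ` A) \<in> enat ` A" by (auto simp: Inf_enat_def intro: LeastI)
  then obtain k where "Inf (enat ` A) = enat k" "k \<in> A" by auto
  moreover have "k \<le> i" if "i \<in> A" for i
    using Inf_lower[of "enat i" "enat ` A"] that calculation(1) by simp
  ultimately show thesis using that by (simp add: is_min_def)
qed

theorem proposition3:
  fixes u :: "nat \<Rightarrow> real"
  assumes "u \<in> c0"
  shows "Argmax u \<subseteq> Delta_ge u
    \<and> (K_ge u < \<infinity> \<longrightarrow> is_min (enat ` Argmax u) (K_ge u))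
    \<and> (K_gt u < \<infinity> \<longrightarrow> S u 0 \<infinity> > 0 \<and> is_max (enat ` Argmax u) (K_gt u))
    \<and> (Argmax u \<noteq> {} \<longleftrightarrow> Delta_ge u \<noteq> {})
    \<and> (Argmax u = {} \<longrightarrow> S u 0 \<infinity> = lim u \<and> lim u = 0)"
proof (intro conjI impI)
  note Delta_ge_iff = Delta_ge_iff_Argmax[OF assms]
  show sub: "Argmax u \<subseteq> Delta_ge u" using Delta_ge_iff by blast
  show "is_min (enat ` Argmax u) (K_ge u)" if "K_ge u < \<infinity>"
  proof -
    obtain k where K: "K_ge u = enat k" and "is_min (Delta_ge u) k"
      using \<open>K_ge u < \<infinity>\<close> by (rule Inf_enat_image_least[of "Delta_ge u", folded K_ge_def])
    then have k: "k \<in> Delta_ge u" "\<And>i. i \<in> Delta_ge u \<Longrightarrow> k \<le> i"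
      by (auto simp: is_min_def)
    obtain j where "j \<le> k" "j \<in> Argmax u" using k(1) Delta_ge_iff by blast
    moreover have "k \<le> i" if "i \<in> Argmax u" for i using that k(2) sub by blast
    ultimately have "k \<in> Argmax u" by (metis le_antisym)
    then show ?thesis using k(2) sub by (auto simp: is_min_def K)
  qed
  show "S u 0 \<infinity> > 0" and "is_max (enat ` Argmax u) (K_gt u)" if "K_gt u < \<infinity>"
  proof -
    obtain k where K: "K_gt u = enat k" and "is_min (Delta_gt u) k"
      using \<open>K_gt u < \<infinity>\<close> by (rule Inf_enat_image_least[of "Delta_gt u", folded K_gt_def])
    then have k: "k \<in> Delta_gt u" "\<And>i. i \<in> Delta_gt u \<Longrightarrow> k \<le> i"
      by (auto simp: is_min_def)
    show "S u 0 \<infinity> > 0"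
      using k(1) S_infinity_nonneg[OF assms, of "k + 1"] S_split[OF assms, of k]
      by (simp add: Delta_gt_def)
    show "is_max (enat ` Argmax u) (K_gt u)"
      using least_Delta_gt_in_Argmax[OF assms k] Argmax_le_Delta_gt[OF assms k(1)]
      by (auto simp: is_max_def K)
  qed
  show "Argmax u \<noteq> {} \<longleftrightarrow> Delta_ge u \<noteq> {}" using Delta_ge_iff by blast
  show lim: "lim u = 0" using assms by (simp add: c0_def limI)
  show "S u 0 \<infinity> = lim u" if "Argmax u = {}"
    using that Argmax_nonempty_of_pos[OF assms] S_infinity_nonneg[OF assms, of 0] lim
    by (metis order_le_imp_less_or_eq)
qed

end
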